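(* Suppose $f$ and $\Psi$ satisfy, for some constant $M>0$, the joint smoothness and strong convexity property: for all $x,s\in\mathrm{dom}(\Psi)$ (and $g\in\partial f(x)$ used in $D_f(\cdot,x)$) and all $\theta\in[0,1)$, $$D_f(x+\theta(s-x),x) \le \frac{M\theta}{1-\theta}\Big[(1-\theta)\Psi(x) + \theta\Psi(s) - \Psi(x+\theta(s-x))\Big].$$ Suppose the generalized conditional subgradient algorithm described in the context chooses $\theta_k$, $k=1,2,\dots$, via the line-search procedure $$\theta_k \in \mathrm{argmin}_{\theta \in [0,1]}\big\{(1-\theta)\,\mathsf{CGgap}_k + D(x_{k},s_k,\theta)\big\},$$ with $\mathsf{CGgap}_k$ and $D$ as defined in the context. Then its iterates satisfy, for $k=1,2,\dots$, $$f(x_k) + \Psi(x_k) + f^*(u_k) + \Psi^*(-u_k) \le \left(\frac{M}{M+1}\right)^{k-1} D_f(s_0,x_0).$$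
   Context: Setting. $E$ is a real vector space with continuous dual $E^*$ and pairing $\langle\cdot,\cdot\rangle$; $f,\Psi:E\to\mathbb{R}\cup\{\infty\}$ are closed convex functions with $\mathrm{dom}(\Psi)\subseteq\mathrm{dom}(\partial f)$. For a function $\phi$, $\phi^*(v)=\sup_x\{\langle v,x\rangle-\phi(x)\}$ is its convex conjugate. Generalized conditional subgradient algorithm. Input $x_0\in\mathrm{dom}(\partial f)$. For $k=0,1,2,\dots$: pick $g_k\in\partial f(x_k)$; pick $s_k\in\mathrm{argmin}_s\{\langle g_k,s\rangle+\Psi(s)\}$; pick $\theta_k\in[0,1]$; let $x_{k+1}=(1-\theta_k)x_k+\theta_ks_k$. It is assumed that at each iteration the minimizer $s_k$ exists, and that $\theta_0=1$ and $\theta_k\in(0,1)$ for $k\ge1$. Dual averages. Let $t_k>0$, $k=0,1,\dots$, be such that $\theta_k=t_k/\sum_{i=0}^kt_i$ for all $k$ (these are determined by $(\theta_k)$ up to a common positive factor), and for $k\ge1$ let $u_k=\sum_{i=0}^{k-1}t_ig_i/\sum_{i=0}^{k-1}t_i$; equivalently $u_1=g_0$ and $u_{k+1}=(1-\theta_k)u_k+\theta_kg_k$. Definition of $D_f$, $D$ and $\mathsf{CGgap}$. $D_f(y,x)=f(y)-f(x)-\langle g,y-x\rangle$ with $g\in\partial f(x)$; when $x=x_k$ is an iterate, $g=g_k$ is used, and the hypothesis on $f,\Psi$ is understood for every $g\in\partial f(x)$. For $x,s\in\mathrm{dom}(\Psi)$, $\theta\in[0,1]$, $$D(x,s,\theta)=D_f(x+\theta(s-x),x)+\Psi(x+\theta(s-x))-(1-\theta)\Psi(x)-\theta\Psi(s).$$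 The numbers $\mathsf{CGgap}_k$, $k\ge1$, are defined by $\mathsf{CGgap}_1=D_f(s_0,x_0)$ and $\mathsf{CGgap}_{k+1}=(1-\theta_k)\mathsf{CGgap}_k+D(x_k,s_k,\theta_k)$ for $k\ge1$. *)

theory Defs
  imports "HOL-Analysis.Analysis"
begin

(* Real topological vector spaces; no norm, local convexity or separation axiom is imposed. *)

class real_tvs = real_vector + topological_ab_group_add +
  assumes tendsto_scaleR_Pair:
    "LIM z (nhds c \<times>\<^sub>F nhds x). fst z *\<^sub>R snd z :> nhds (c *\<^sub>R x)"

instance real_normed_vector \<subseteq> real_tvs
proof
  fix c :: real and x :: 'a
  show "LIM z (nhds c \<times>\<^sub>F nhds x). fst z *\<^sub>R snd z :> nhds (c *\<^sub>R x)"
    by (intro tendsto_scaleR filterlim_fst filterlim_snd)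
qed

definition continuous_dual :: "('a::real_tvs \<Rightarrow> real) set" where
  "continuous_dual = {v. linear v \<and> continuous_on UNIV v}"

definition eff_dom :: "('a \<Rightarrow> ereal) \<Rightarrow> 'a set" where
  "eff_dom \<phi> = {x. \<phi> x < \<infinity>}"

definition ereal_epigraph :: "('a \<Rightarrow> ereal) \<Rightarrow> ('a \<times> real) set" where
  "ereal_epigraph \<phi> = {(x, r). \<phi> x \<le> ereal r}"

(* The first conjunct says that the function takes its values in the reals extended by
   plus infinity only. The function that is constantly infinity is allowed. *)

definition closed_convex_fun :: "('a::real_tvs \<Rightarrow> ereal) \<Rightarrow> bool" where
  "closed_convex_fun \<phi> \<longleftrightarrow>
     (\<forall>x. \<phi> x \<noteq> -\<infinity>) \<and> closed (ereal_epigraph \<phi>) \<and> convex (ereal_epigraph \<phi>)"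

definition subdiff :: "('a::real_tvs \<Rightarrow> ereal) \<Rightarrow> 'a \<Rightarrow> ('a \<Rightarrow> real) set" where
  "subdiff \<phi> x =
     {g \<in> continuous_dual. x \<in> eff_dom \<phi> \<and> (\<forall>y. \<phi> x + ereal (g (y - x)) \<le> \<phi> y)}"

definition subdiff_dom :: "('a::real_tvs \<Rightarrow> ereal) \<Rightarrow> 'a set" where
  "subdiff_dom \<phi> = {x. subdiff \<phi> x \<noteq> {}}"

definition conjugate :: "('a \<Rightarrow> ereal) \<Rightarrow> ('a \<Rightarrow> real) \<Rightarrow> ereal" where
  "conjugate \<phi> v = (SUP x. ereal (v x) - \<phi> x)"

(* D_f(y, x), with the chosen subgradient g of f at x as an explicit argument. *)

definition bregman :: "('a::real_vector \<Rightarrow> ereal) \<Rightarrow> ('a \<Rightarrow> real) \<Rightarrow> 'a \<Rightarrow> 'a \<Rightarrow> ereal" where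
  "bregman f g y x = f y - f x - ereal (g (y - x))"

definition cg_D :: "('a::real_vector \<Rightarrow> ereal) \<Rightarrow> ('a \<Rightarrow> ereal) \<Rightarrow> ('a \<Rightarrow> real) \<Rightarrow>
    'a \<Rightarrow> 'a \<Rightarrow> real \<Rightarrow> ereal" where
  "cg_D f \<Psi> g x s \<theta> =
     bregman f g (x + \<theta> *\<^sub>R (s - x)) x + \<Psi> (x + \<theta> *\<^sub>R (s - x))
       - ereal (1 - \<theta>) * \<Psi> x - ereal \<theta> * \<Psi> s"

(* CGgap is indexed from 1; the value at 0 is a dummy. *)

fun CGgap :: "('a::real_vector \<Rightarrow> ereal) \<Rightarrow> ('a \<Rightarrow> ereal) \<Rightarrow> (nat \<Rightarrow> 'a \<Rightarrow> real) \<Rightarrow>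
    (nat \<Rightarrow> 'a) \<Rightarrow> (nat \<Rightarrow> 'a) \<Rightarrow> (nat \<Rightarrow> real) \<Rightarrow> nat \<Rightarrow> ereal" where
  "CGgap f \<Psi> g x s \<theta> 0 = 0"
| "CGgap f \<Psi> g x s \<theta> (Suc 0) = bregman f (g 0) (s 0) (x 0)"
| "CGgap f \<Psi> g x s \<theta> (Suc (Suc k)) =
     ereal (1 - \<theta> (Suc k)) * CGgap f \<Psi> g x s \<theta> (Suc k)
       + cg_D f \<Psi> (g (Suc k)) (x (Suc k)) (s (Suc k)) (\<theta> (Suc k))"

definition gen_cond_subgradient_run :: "('a::real_tvs \<Rightarrow> ereal) \<Rightarrow> ('a \<Rightarrow> ereal) \<Rightarrow>
    (nat \<Rightarrow> 'a) \<Rightarrow> (nat \<Rightarrow> 'a \<Rightarrow> real) \<Rightarrow> (nat \<Rightarrow> 'a) \<Rightarrow> (nat \<Rightarrow> real) \<Rightarrow> bool" where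
  "gen_cond_subgradient_run f \<Psi> x g s \<theta> \<longleftrightarrow>
     x 0 \<in> subdiff_dom f \<and>
     (\<forall>k. g k \<in> subdiff f (x k) \<and>
          is_arg_min (\<lambda>v. ereal (g k v) + \<Psi> v) (\<lambda>_. True) (s k) \<and>
          \<theta> k \<in> {0..1} \<and>
          x (Suc k) = (1 - \<theta> k) *\<^sub>R x k + \<theta> k *\<^sub>R s k)"

definition dual_average :: "(nat \<Rightarrow> real) \<Rightarrow> (nat \<Rightarrow> 'a \<Rightarrow> real) \<Rightarrow> nat \<Rightarrow> 'a \<Rightarrow> real" where
  "dual_average t g k = (\<lambda>v. (\<Sum>i<k. t i * g i v) / (\<Sum>i<k. t i))"

(* All subgradients of f at x are quantified, not just one selected subgradient. *)

definition joint_smooth_strongly_convex ::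
    "real \<Rightarrow> ('a::real_tvs \<Rightarrow> ereal) \<Rightarrow> ('a \<Rightarrow> ereal) \<Rightarrow> bool" where
  "joint_smooth_strongly_convex M f \<Psi> \<longleftrightarrow>
     (\<forall>x \<in> eff_dom \<Psi>. \<forall>s \<in> eff_dom \<Psi>. \<forall>g \<in> subdiff f x. \<forall>\<theta> \<in> {0..<1}.
        bregman f g (x + \<theta> *\<^sub>R (s - x)) x
          \<le> ereal (M * \<theta> / (1 - \<theta>)) *
            (ereal (1 - \<theta>) * \<Psi> x + ereal \<theta> * \<Psi> s - \<Psi> (x + \<theta> *\<^sub>R (s - x))))"

end

theory Submission
  imports Defs
begin

text \<open>
  The argument separates into an upper bound for the primal-dual gap and a contraction of that bound.

  The gap is bounded by \<open>CGgap\<close> because the pair \<open>(x k, u k)\<close> moves by convex combinations, primally towards \<open>s k\<close> and dually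
  towards \<open>g k\<close>, with the same weight \<open>\<theta> k\<close>. The conjugates are convex, and at \<open>g k\<close> they are
  known exactly: the Fenchel equality gives \<open>f\<^sup>*(g k) = g k (x k) - f (x k)\<close> because \<open>g k\<close> is a
  subgradient at \<open>x k\<close>, and \<open>\<Psi>\<^sup>*(- g k) = - g k (s k) - \<Psi> (s k)\<close> because \<open>s k\<close> minimizes
  \<open>g k + \<Psi>\<close>. Substituting these two values, the gap at step \<open>k + 1\<close> exceeds \<open>1 - \<theta> k\<close> times the gap
  at step \<open>k\<close> by at most \<open>D (x k, s k, \<theta> k)\<close>. This is the recursion that defines \<open>CGgap\<close>, so
  \<open>CGgap k\<close> bounds the gap (lemmas \<open>gap_at_most_start\<close> and \<open>gap_at_most_step\<close>).

  For the contraction, write \<open>B\<close> for the convexity defect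
  \<open>(1 - \<theta>) \<Psi> x + \<theta> \<Psi> s - \<Psi> (x + \<theta> (s - x))\<close>. Then \<open>D = D\<^sub>f - B\<close>, and the joint condition bounds
  \<open>D\<^sub>f\<close> by \<open>(M \<theta> / (1 - \<theta>)) B\<close>. The factor equals one exactly at \<open>\<theta> = 1 / (M + 1)\<close>, where
  therefore \<open>D \<le> 0\<close> (lemma \<open>cg_D_nonpos\<close>). The line search does at least as well as this fixed step,
  so \<open>CGgap\<close> shrinks by \<open>1 - 1 / (M + 1) = M / (M + 1)\<close> in every iteration.
\<close>

section \<open>Upper bounds for conjugates\<close>

lemma conjugate_le_iff:
  "conjugate \<phi> v \<le> c \<longleftrightarrow> (\<forall>y. ereal (v y) - \<phi> y \<le> c)"
  by (simp add: conjugate_def SUP_le_iff)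

text \<open>
  Convexity of the conjugate. Only real upper bounds are combined, which avoids sums of opposite
  infinities.
\<close>

lemma conjugate_convex_combination_le:
  assumes "conjugate \<phi> u \<le> ereal a" and "conjugate \<phi> v \<le> ereal b" and "\<tau> \<in> {0..1}"
  shows "conjugate \<phi> (\<lambda>y. (1 - \<tau>) * u y + \<tau> * v y) \<le> ereal ((1 - \<tau>) * a + \<tau> * b)"
  unfolding conjugate_le_iff
proof
  fix y
  have u: "ereal (u y) - \<phi> y \<le> ereal a" and v: "ereal (v y) - \<phi> y \<le> ereal b"
    using assms(1,2) by (auto simp: conjugate_le_iff)
  show "ereal ((1 - \<tau>) * u y + \<tau> * v y) - \<phi> y \<le> ereal ((1 - \<tau>) * a + \<tau> * b)"
  proof (cases "\<phi> y")
    case (real r)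
    have "(1 - \<tau>) * (u y - r) + \<tau> * (v y - r) \<le> (1 - \<tau>) * a + \<tau> * b"
      using u v real assms(3) by (intro add_mono mult_left_mono) auto
    then show ?thesis
      using real by (simp add: algebra_simps)
  qed (use u in auto)
qed

text \<open>
  The half of the Fenchel equality for a subgradient that the gap needs.
\<close>

lemma conjugate_subgradient_le:
  assumes "g \<in> subdiff f x" and fx: "f x = ereal a"
  shows "conjugate f g \<le> ereal (g x - a)"
  unfolding conjugate_le_iff
proof
  fix y
  have "ereal (a + g (y - x)) \<le> f y" and "linear g"
    using assms by (auto simp: subdiff_def continuous_dual_def)
  then show "ereal (g y) - f y \<le> ereal (g x - a)"
    by (cases "f y") (auto simp: linear_diff)
qed

lemma conjugate_neg_arg_min_le:
  assumes "is_arg_min (\<lambda>v. ereal (g v) + \<Psi> v) (\<lambda>_. True) s" and ps: "\<Psi> s = ereal p"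
  shows "conjugate \<Psi> (\<lambda>v. - g v) \<le> ereal (- g s - p)"
  unfolding conjugate_le_iff
proof
  fix y
  have "ereal (g s + p) \<le> ereal (g y) + \<Psi> y"
    using assms by (auto simp: is_arg_min_def not_less)
  then show "ereal (- g y) - \<Psi> y \<le> ereal (- g s - p)"
    by (cases "\<Psi> y") auto
qed

section \<open>Effective domains\<close>

lemma arg_min_in_eff_dom:
  assumes "is_arg_min (\<lambda>v. ereal (g v) + \<Psi> v) (\<lambda>_. True) s" and "eff_dom \<Psi> \<noteq> {}"
  shows "s \<in> eff_dom \<Psi>"
proof -
  obtain z where "\<Psi> z < \<infinity>"
    using assms(2) by (auto simp: eff_dom_def)
  moreover have "ereal (g s) + \<Psi> s \<le> ereal (g z) + \<Psi> z"
    using assms(1) by (auto simp: is_arg_min_def not_less)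
  ultimately show ?thesis
    by (cases "\<Psi> z"; cases "\<Psi> s") (auto simp: eff_dom_def)
qed

lemma closed_convex_fun_finite:
  assumes "closed_convex_fun \<phi>" and "x \<in> eff_dom \<phi>"
  obtains r where "\<phi> x = ereal r"
  using assms by (cases "\<phi> x") (auto simp: closed_convex_fun_def eff_dom_def)

lemma subdiff_dom_subset_eff_dom: "subdiff_dom f \<subseteq> eff_dom f"
  by (auto simp: subdiff_dom_def subdiff_def)

lemma eff_dom_segment:
  assumes "closed_convex_fun \<phi>" and "x \<in> eff_dom \<phi>" and "s \<in> eff_dom \<phi>" and "\<tau> \<in> {0..1}"
  shows "x + \<tau> *\<^sub>R (s - x) \<in> eff_dom \<phi>"
proof -
  obtain p q where "\<phi> x = ereal p" "\<phi> s = ereal q"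
    using assms closed_convex_fun_finite by metis
  then have "(x, p) \<in> ereal_epigraph \<phi>" "(s, q) \<in> ereal_epigraph \<phi>"
    by (auto simp: ereal_epigraph_def)
  moreover have "convex (ereal_epigraph \<phi>)"
    using assms(1) by (simp add: closed_convex_fun_def)
  ultimately have "(1 - \<tau>) *\<^sub>R (x, p) + \<tau> *\<^sub>R (s, q) \<in> ereal_epigraph \<phi>"
    using assms(4) by (intro convexD) auto
  moreover have "(1 - \<tau>) *\<^sub>R x + \<tau> *\<^sub>R s = x + \<tau> *\<^sub>R (s - x)"
    by (simp add: algebra_simps)
  ultimately have "\<phi> (x + \<tau> *\<^sub>R (s - x)) \<le> ereal ((1 - \<tau>) * p + \<tau> * q)"
    by (simp add: ereal_epigraph_def)
  then show ?thesis
    by (auto simp: eff_dom_def)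
qed

section \<open>Dual averages\<close>

lemma dual_average_1:
  assumes "t 0 \<noteq> 0"
  shows "dual_average t g (Suc 0) = g 0"
  using assms by (auto simp: dual_average_def)

lemma dual_average_Suc:
  assumes "\<And>j. t j > 0" and "k \<ge> 1" and "\<tau> = t k / (\<Sum>i\<le>k. t i)"
  shows "dual_average t g (Suc k) = (\<lambda>v. (1 - \<tau>) * dual_average t g k v + \<tau> * g k v)"
proof
  fix v
  define T where "T = (\<Sum>i<k. t i)"
  have T: "T > 0"
    unfolding T_def using assms(1,2) by (intro sum_pos) (auto simp: lessThan_empty_iff)
  have \<tau>: "\<tau> = t k / (T + t k)"
    using assms(3) by (simp add: T_def lessThan_Suc_atMost[symmetric])
  have pos: "T + t k > 0"
    using T assms(1)[of k] by simp
  then have "1 - \<tau> = T / (T + t k)"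
    by (simp add: \<tau> field_simps)
  then show "dual_average t g (Suc k) v = (1 - \<tau>) * dual_average t g k v + \<tau> * g k v"
    using T by (simp add: dual_average_def T_def[symmetric] \<tau> add_divide_distrib)
qed

section \<open>Bregman distances and convexity defects\<close>

lemma bregman_ereal:
  assumes "linear g" and "f y = ereal b" and "f x = ereal a"
  shows "bregman f g y x = ereal (b - a - (g y - g x))"
  using assms by (simp add: bregman_def linear_diff)

lemma cg_D_ereal:
  assumes "linear g" and "f x = ereal a" and "f (x + \<tau> *\<^sub>R (s - x)) = ereal b"
    and "\<Psi> x = ereal p" and "\<Psi> s = ereal q" and "\<Psi> (x + \<tau> *\<^sub>R (s - x)) = ereal r"
  shows "cg_D f \<Psi> g x s \<tau> = ereal (b - a - \<tau> * (g s - g x) + r - (1 - \<tau>) * p - \<tau> * q)"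
  using assms by (simp add: cg_D_def bregman_def linear_diff linear_scale)

text \<open>
  The joint condition is evaluated at the step length for which its factor \<open>M \<tau> / (1 - \<tau>)\<close> is one:
  there the Bregman distance is at most the convexity defect of \<open>\<Psi>\<close> that \<open>D\<close> subtracts from it.
\<close>

lemma cg_D_nonpos:
  assumes "closed_convex_fun f" and "closed_convex_fun \<Psi>" and "eff_dom \<Psi> \<subseteq> eff_dom f"
    and "M > 0" and "joint_smooth_strongly_convex M f \<Psi>"
    and "x \<in> eff_dom \<Psi>" and "s \<in> eff_dom \<Psi>" and "g \<in> subdiff f x"
  shows "cg_D f \<Psi> g x s (1 / (M + 1)) \<le> 0"
proof -
  define \<tau> where "\<tau> = 1 / (M + 1)"
  define z where "z = x + \<tau> *\<^sub>R (s - x)"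
  have \<tau>: "\<tau> \<in> {0..<1}" and factor: "M * \<tau> / (1 - \<tau>) = 1"
    using assms(4) by (auto simp: \<tau>_def field_simps)
  have z_dom: "z \<in> eff_dom \<Psi>"
    unfolding z_def using assms \<tau> by (intro eff_dom_segment) auto
  obtain p q r where \<Psi>: "\<Psi> x = ereal p" "\<Psi> s = ereal q" "\<Psi> z = ereal r"
    using assms(2,6,7) z_dom closed_convex_fun_finite by metis
  obtain a b where f: "f x = ereal a" "f z = ereal b"
    using assms(1,3,6) z_dom closed_convex_fun_finite by (metis subsetD)
  have "bregman f g z x
      \<le> ereal (M * \<tau> / (1 - \<tau>)) * (ereal (1 - \<tau>) * \<Psi> x + ereal \<tau> * \<Psi> s - \<Psi> z)"
    using assms(5-8) \<tau> unfolding joint_smooth_strongly_convex_def z_def by blast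
  then have "bregman f g z x \<le> ereal ((1 - \<tau>) * p + \<tau> * q - r)"
    unfolding factor by (simp add: \<Psi>)
  moreover have "cg_D f \<Psi> g x s \<tau>
      = bregman f g z x + \<Psi> z - ereal (1 - \<tau>) * \<Psi> x - ereal \<tau> * \<Psi> s"
    by (simp add: cg_D_def z_def)
  ultimately have "cg_D f \<Psi> g x s \<tau> \<le> 0"
    using f by (simp add: \<Psi> bregman_def algebra_simps)
  then show ?thesis
    by (simp add: \<tau>_def)
qed

section \<open>The primal-dual gap along one iteration\<close>

text \<open>
  The gap is certified by real upper bounds \<open>a\<close> and \<open>b\<close> of the two conjugates, so that its recursion
  is real arithmetic; the conjugates in \<open>ereal\<close> reappear only in \<open>gap_at_mostD\<close>.
\<close>

definition gap_at_most ::
    "('a \<Rightarrow> ereal) \<Rightarrow> ('a \<Rightarrow> ereal) \<Rightarrow> 'a \<Rightarrow> ('a \<Rightarrow> real) \<Rightarrow> real \<Rightarrow> bool" where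
  "gap_at_most f \<Psi> x u c \<longleftrightarrow>
     (\<exists>p q a b. f x = ereal p \<and> \<Psi> x = ereal q \<and> conjugate f u \<le> ereal a \<and>
        conjugate \<Psi> (\<lambda>v. - u v) \<le> ereal b \<and> p + q + a + b \<le> c)"

lemma gap_at_mostD:
  assumes "gap_at_most f \<Psi> x u c"
  shows "f x + \<Psi> x + conjugate f u + conjugate \<Psi> (\<lambda>v. - u v) \<le> ereal c"
proof -
  obtain p q a b where gap: "f x = ereal p" "\<Psi> x = ereal q" "conjugate f u \<le> ereal a"
      "conjugate \<Psi> (\<lambda>v. - u v) \<le> ereal b" "p + q + a + b \<le> c"
    using assms by (auto simp: gap_at_most_def)
  have "f x + \<Psi> x + conjugate f u + conjugate \<Psi> (\<lambda>v. - u v)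
      \<le> ereal p + ereal q + ereal a + ereal b"
    using gap by (intro add_mono) auto
  also have "\<dots> \<le> ereal c"
    using gap(5) by simp
  finally show ?thesis .
qed

text \<open>
  With full weight on the first step, the iterate is the minimizer itself, the values of \<open>\<Psi>\<close> at \<open>s\<close>
  cancel, and the Bregman distance remains.
\<close>

lemma gap_at_most_start:
  assumes "g \<in> subdiff f x" and "is_arg_min (\<lambda>v. ereal (g v) + \<Psi> v) (\<lambda>_. True) s"
    and "f x = ereal a" and "f s = ereal b" and "\<Psi> s = ereal q"
    and "bregman f g s x = ereal c"
  shows "gap_at_most f \<Psi> s g c"
proof -
  have "linear g"
    using assms(1) by (simp add: subdiff_def continuous_dual_def)
  then have "b + q + (g x - a) + (- g s - q) \<le> c"
    using assms(6) by (simp add: bregman_ereal[OF _ assms(4,3)])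
  with conjugate_subgradient_le[OF assms(1,3)] conjugate_neg_arg_min_le[OF assms(2,5)] assms(4,5)
  show ?thesis
    unfolding gap_at_most_def by blast
qed

text \<open>
  Both conjugates are bounded by the same convex combination that moves the iterate. The terms that
  do not come from the old gap add up to \<open>D\<close>: the value \<open>f x\<close> occurs with weight \<open>1 - \<tau>\<close> from the old
  gap and with weight \<open>\<tau>\<close> from the Fenchel equality.
\<close>

lemma gap_at_most_step:
  assumes "gap_at_most f \<Psi> x u c"
    and "g \<in> subdiff f x" and "is_arg_min (\<lambda>v. ereal (g v) + \<Psi> v) (\<lambda>_. True) s"
    and "\<tau> \<in> {0..1}" and s: "\<Psi> s = ereal q'"
    and z: "f (x + \<tau> *\<^sub>R (s - x)) = ereal b'" "\<Psi> (x + \<tau> *\<^sub>R (s - x)) = ereal r'"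
    and D: "cg_D f \<Psi> g x s \<tau> = ereal d"
  shows "gap_at_most f \<Psi> (x + \<tau> *\<^sub>R (s - x)) (\<lambda>v. (1 - \<tau>) * u v + \<tau> * g v) ((1 - \<tau>) * c + d)"
proof -
  obtain p q a b where gap: "f x = ereal p" "\<Psi> x = ereal q" "conjugate f u \<le> ereal a"
      "conjugate \<Psi> (\<lambda>v. - u v) \<le> ereal b" "p + q + a + b \<le> c"
    using assms(1) by (auto simp: gap_at_most_def)
  have "linear g"
    using assms(2) by (simp add: subdiff_def continuous_dual_def)
  then have d: "d = b' - p - \<tau> * (g s - g x) + r' - (1 - \<tau>) * q - \<tau> * q'"
    using D cg_D_ereal[OF _ gap(1) z(1) gap(2) s z(2)] by simp
  have f: "conjugate f (\<lambda>v. (1 - \<tau>) * u v + \<tau> * g v) \<le> ereal ((1 - \<tau>) * a + \<tau> * (g x - p))"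
    by (rule conjugate_convex_combination_le[OF gap(3) conjugate_subgradient_le[OF assms(2) gap(1)] assms(4)])
  have "conjugate \<Psi> (\<lambda>v. (1 - \<tau>) * - u v + \<tau> * - g v)
      \<le> ereal ((1 - \<tau>) * b + \<tau> * (- g s - q'))"
    by (rule conjugate_convex_combination_le[OF gap(4) conjugate_neg_arg_min_le[OF assms(3) s] assms(4)])
  then have \<Psi>: "conjugate \<Psi> (\<lambda>v. - ((1 - \<tau>) * u v + \<tau> * g v))
      \<le> ereal ((1 - \<tau>) * b + \<tau> * (- g s - q'))"
    by simp
  have "(1 - \<tau>) * (p + q + a + b) \<le> (1 - \<tau>) * c"
    using gap(5) assms(4) by (intro mult_left_mono) auto
  then have "b' + r' + ((1 - \<tau>) * a + \<tau> * (g x - p)) + ((1 - \<tau>) * b + \<tau> * (- g s - q'))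
      \<le> (1 - \<tau>) * c + d"
    unfolding d by (simp add: algebra_simps)
  with z f \<Psi> show ?thesis
    unfolding gap_at_most_def by blast
qed

section \<open>Linear convergence under line search\<close>

theorem proposition2:
  fixes f \<Psi> :: "'a::real_tvs \<Rightarrow> ereal"
    and x s :: "nat \<Rightarrow> 'a"
    and g :: "nat \<Rightarrow> 'a \<Rightarrow> real"
    and \<theta> t :: "nat \<Rightarrow> real"
    and M :: real
    and k :: nat
  assumes "closed_convex_fun f" and "closed_convex_fun \<Psi>"
    and "eff_dom \<Psi> \<noteq> {}"
    and "eff_dom \<Psi> \<subseteq> subdiff_dom f"
    and "M > 0"
    and "joint_smooth_strongly_convex M f \<Psi>"
    and "gen_cond_subgradient_run f \<Psi> x g s \<theta>"
    and "\<theta> 0 = 1"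
    and "\<And>j. j \<ge> 1 \<Longrightarrow> \<theta> j \<in> {0<..<1}"
    and "\<And>j. t j > 0"
    and "\<And>j. \<theta> j = t j / (\<Sum>i\<le>j. t i)"
    and "\<And>j. j \<ge> 1 \<Longrightarrow>
           is_arg_min (\<lambda>\<tau>. ereal (1 - \<tau>) * CGgap f \<Psi> g x s \<theta> j + cg_D f \<Psi> (g j) (x j) (s j) \<tau>)
             (\<lambda>\<tau>. \<tau> \<in> {0..1}) (\<theta> j)"
    and "k \<ge> 1"
  shows "f (x k) + \<Psi> (x k) + conjugate f (dual_average t g k)
           + conjugate \<Psi> (\<lambda>v. - dual_average t g k v)
         \<le> ereal ((M / (M + 1)) ^ (k - 1)) * bregman f (g 0) (s 0) (x 0)"
proof -
  note run = assms(7)[unfolded gen_cond_subgradient_run_def]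
  let ?C = "CGgap f \<Psi> g x s \<theta>"
  let ?q = "M / (M + 1)"
  let ?D0 = "bregman f (g 0) (s 0) (x 0)"
  have sub: "g j \<in> subdiff f (x j)"
    and min: "is_arg_min (\<lambda>v. ereal (g j v) + \<Psi> v) (\<lambda>_. True) (s j)" for j
    using run by auto
  have lin: "linear (g j)" for j
    using sub[of j] by (simp add: subdiff_def continuous_dual_def)
  have dom_sub: "eff_dom \<Psi> \<subseteq> eff_dom f"
    using assms(4) subdiff_dom_subset_eff_dom by blast
  have s_dom: "s j \<in> eff_dom \<Psi>" for j
    using arg_min_in_eff_dom[OF min assms(3)] .
  have x_Suc: "x (Suc j) = x j + \<theta> j *\<^sub>R (s j - x j)" for j
    using run by (simp add: algebra_simps)
  have finite_f: "\<exists>r. f y = ereal r" if "y \<in> eff_dom f" for y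
    using closed_convex_fun_finite[OF assms(1) that] by blast
  have finite_\<Psi>: "\<exists>r. \<Psi> y = ereal r" if "y \<in> eff_dom \<Psi>" for y
    using closed_convex_fun_finite[OF assms(2) that] by blast

  obtain a b q where start: "f (x 0) = ereal a" "f (s 0) = ereal b" "\<Psi> (s 0) = ereal q"
    using finite_f finite_\<Psi> s_dom dom_sub subdiff_dom_subset_eff_dom run by (metis subsetD)
  then obtain d0 where d0: "?D0 = ereal d0"
    using bregman_ereal[OF lin] by blast
  \<comment> \<open>The initial point may lie outside the domain of \<open>\<Psi>\<close>, so the induction starts at index 1.\<close>
  have main: "\<exists>c. ?C (Suc j) = ereal c \<and> c \<le> ?q ^ j * d0 \<and> x (Suc j) \<in> eff_dom \<Psi> \<and>
      gap_at_most f \<Psi> (x (Suc j)) (dual_average t g (Suc j)) c" for j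
  proof (induction j)
    case 0
    have "x (Suc 0) = s 0"
      using x_Suc[of 0] assms(8) by simp
    moreover have "dual_average t g (Suc 0) = g 0"
      using assms(10)[of 0] by (intro dual_average_1) simp
    ultimately show ?case
      using gap_at_most_start[OF sub min start d0] d0 s_dom by simp
  next
    case (Suc j)
    let ?k = "Suc j"
    let ?z = "\<lambda>\<tau>. x ?k + \<tau> *\<^sub>R (s ?k - x ?k)"
    let ?D = "cg_D f \<Psi> (g ?k) (x ?k) (s ?k)"
    obtain c where c: "?C ?k = ereal c" "c \<le> ?q ^ j * d0"
      and x_dom: "x ?k \<in> eff_dom \<Psi>"
      and gap: "gap_at_most f \<Psi> (x ?k) (dual_average t g ?k) c"
      using Suc.IH by blast
    have \<theta>: "\<theta> ?k \<in> {0..1}"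
      using run by blast
    have z_dom: "?z (\<theta> ?k) \<in> eff_dom \<Psi>"
      using eff_dom_segment[OF assms(2) x_dom s_dom \<theta>] .
    obtain b' r' q' where z: "f (?z (\<theta> ?k)) = ereal b'" "\<Psi> (?z (\<theta> ?k)) = ereal r'"
      and s: "\<Psi> (s ?k) = ereal q'"
      using finite_f finite_\<Psi> s_dom z_dom dom_sub by (meson subsetD)
    obtain p' a' where x_fin: "\<Psi> (x ?k) = ereal p'" "f (x ?k) = ereal a'"
      using finite_f finite_\<Psi> x_dom dom_sub by (meson subsetD)
    obtain d where d: "?D (\<theta> ?k) = ereal d"
      using cg_D_ereal[OF lin x_fin(2) z(1) x_fin(1) s z(2)] by blast
    have C: "?C (Suc ?k) = ereal ((1 - \<theta> ?k) * c + d)"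
      using c(1) d by simp
    have "gap_at_most f \<Psi> (x (Suc ?k)) (dual_average t g (Suc ?k)) ((1 - \<theta> ?k) * c + d)"
      using gap_at_most_step[OF gap sub min \<theta> s z d]
        dual_average_Suc[OF assms(10) _ assms(11), of ?k g]
      by (simp add: x_Suc)
    moreover have "(1 - \<theta> ?k) * c + d \<le> ?q ^ ?k * d0"
    proof -
      \<comment> \<open>The line search competes with the fixed step length at which \<open>D\<close> is nonpositive.\<close>
      let ?\<tau> = "1 / (M + 1)"
      have "?\<tau> \<in> {0..1}"
        using assms(5) by simp
      then have "ereal (1 - \<theta> ?k) * ?C ?k + ?D (\<theta> ?k) \<le> ereal (1 - ?\<tau>) * ?C ?k + ?D ?\<tau>"
        using assms(12)[of ?k] unfolding is_arg_min_def by (auto simp: not_less)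
      also have "\<dots> \<le> ereal (1 - ?\<tau>) * ?C ?k + 0"
        using cg_D_nonpos[OF assms(1,2) dom_sub assms(5,6) x_dom s_dom sub]
        by (intro add_left_mono)
      finally have "(1 - \<theta> ?k) * c + d \<le> (1 - ?\<tau>) * c"
        by (simp add: c(1) d)
      also have "1 - ?\<tau> = ?q"
        using assms(5) by (simp add: field_simps)
      also have "?q * c \<le> ?q * (?q ^ j * d0)"
        using c(2) assms(5) by (intro mult_left_mono) auto
      finally show ?thesis
        by (simp add: mult.assoc)
    qed
    ultimately show ?case
      using C z_dom by (simp only: x_Suc[of ?k]) blast
  qed
  obtain j where k: "k = Suc j"
    using assms(13) by (cases k) auto
  obtain c where c: "c \<le> ?q ^ j * d0"
    and gap: "gap_at_most f \<Psi> (x k) (dual_average t g k) c"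
    using main[of j] k by blast
  note gap_at_mostD[OF gap]
  also have "ereal c \<le> ereal (?q ^ j * d0)"
    using c by simp
  finally show ?thesis
    by (simp add: k d0)
qed

end
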